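(* The parametric representation of a Single Gaussian Radiance Field is not unique: there exist parameter sets $\boldsymbol{\theta}_1, \boldsymbol{\theta}_2 \in \Theta$ with $\boldsymbol{\theta}_1 \neq \boldsymbol{\theta}_2$ that generate exactly the same field, i.e. $\phi_{\boldsymbol{\theta}_1}(\mathbf{x},\mathbf{d}) = \phi_{\boldsymbol{\theta}_2}(\mathbf{x},\mathbf{d})$ for all $\mathbf{x}\in\mathbb{R}^3$ and all $\mathbf{d}\in\mathbb{S}^2$.
   Context: Fix a maximal degree $L_{\max}\in\mathbb{Z}_{\ge 0}$ and put $K=(L_{\max}+1)^2$. For $0\le l\le L_{\max}$ and $-l\le m\le l$, let $Y_l^m:\mathbb{S}^2\to\mathbb{R}$ denote the real-valued spherical harmonic of degree $l$ and order $m$ on the unit sphere $\mathbb{S}^2\subset\mathbb{R}^3$. Parameter space. $\Theta$ is the set of tuples $\boldsymbol{\theta}=(\boldsymbol{\mu},\mathbf{q},\mathbf{s},\mathbf{c},o)$, regarded as vectors of real numbers, where $\boldsymbol{\mu}\in\mathbb{R}^3$ is a center; $\mathbf{q}\in\mathbb{R}^4$ is a unit quaternion, representing the rotation matrix $R(\mathbf{q})\in \mathrm{SO}(3)$ (the standard map from unit quaternions to rotations); $\mathbf{s}\in(0,\infty)^3$ is a vector of scales; $\mathbf{c}\in\mathbb{R}^{3\times K}$ is an array of spherical harmonic coefficients, with rows indexed by the color channels $r,g,b$ and columns by the pairs $(l,m)$; and $o\in\mathbb{R}$ is an opacity logit. Two parameter sets are distinct if they differ as tuples of real numbers. Generated field.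 Given $\boldsymbol{\theta}\in\Theta$, set $$\Sigma = R(\mathbf{q})\,\mathrm{diag}(\mathbf{s})^2\,R(\mathbf{q})^\top,\qquad \rho(\mathbf{x})=\exp\left(-\tfrac12(\mathbf{x}-\boldsymbol{\mu})^\top\Sigma^{-1}(\mathbf{x}-\boldsymbol{\mu})\right),$$ $$\mathrm{Color}(\mathbf{d})=\left(\sum_{l=0}^{L_{\max}}\sum_{m=-l}^{l}\mathbf{c}_{k,(l,m)}\,Y_l^m(\mathbf{d})\right)_{k\in\{r,g,b\}}\in\mathbb{R}^3,\qquad c(\mathbf{d})=\sigma(o)\,\mathrm{Color}(\mathbf{d}),$$ where $\sigma(t)=1/(1+e^{-t})$ is the sigmoid function. The Single Gaussian Radiance Field (SGRF) generated by $\boldsymbol{\theta}$ is the map $\phi_{\boldsymbol{\theta}}:\mathbb{R}^3\times\mathbb{S}^2\to\mathbb{R}^3$, $\phi_{\boldsymbol{\theta}}(\mathbf{x},\mathbf{d})=\rho(\mathbf{x})\,c(\mathbf{d})$. *)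

theory Defs
  imports "HOL-Analysis.Analysis" "HOL-Computational_Algebra.Polynomial"
begin

text \<open>Legendre polynomials, by Rodrigues' formula.\<close>

definition legendre_poly :: "nat \<Rightarrow> real poly" where
  "legendre_poly l = smult (1 / (2 ^ l * fact l)) ((pderiv ^^ l) ([:-1, 0, 1:] ^ l))"

text \<open>
  The associated Legendre function of degree \<open>l\<close> and order \<open>m \<ge> 0\<close>, without the
  Condon-Shortley sign \<open>(-1)^m\<close>. The factor \<open>(1 - t\<^sup>2)\<close> to the power \<open>m/2\<close> is written with
  \<open>sqrt\<close> because \<open>0 powr 0 = 0\<close> would give wrong values at the poles for \<open>m = 0\<close>.
\<close>

definition assoc_legendre :: "nat \<Rightarrow> nat \<Rightarrow> real \<Rightarrow> real" where
  "assoc_legendre l m t = sqrt (1 - t\<^sup>2) ^ m * poly ((pderiv ^^ m) (legendre_poly l)) t"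

definition sh_norm :: "nat \<Rightarrow> nat \<Rightarrow> real" where
  "sh_norm l m = sqrt ((2 * real l + 1) / (4 * pi) * (fact (l - m) / fact (l + m)))"

text \<open>
  The real spherical harmonic of degree \<open>l\<close> and order \<open>m\<close>, \<open>\<bar>m\<bar> \<le> l\<close>, orthonormal with respect
  to the surface measure. A unit vector \<open>d\<close> has \<open>d $ 3\<close> as the cosine of its polar angle and
  \<open>Arg (Complex (d $ 1) (d $ 2))\<close> as its azimuth. At the poles the azimuth is arbitrary, but
  it only occurs for \<open>m \<noteq> 0\<close>, where the Legendre factor vanishes there. The value is
  meaningful only for \<open>d\<close> on the unit sphere.
\<close>

definition spherical_harmonic :: "nat \<Rightarrow> int \<Rightarrow> real ^ 3 \<Rightarrow> real" where
  "spherical_harmonic l m d =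
     (let k = nat \<bar>m\<bar>;
          \<phi> = Arg (Complex (d $ 1) (d $ 2));
          P = sh_norm l k * assoc_legendre l k (d $ 3)
      in if m = 0 then P
         else if m > 0 then sqrt 2 * P * cos (real k * \<phi>)
         else sqrt 2 * P * sin (real k * \<phi>))"

text \<open>
  The matrix of \<open>v \<mapsto> q v q\<^sup>*\<close> for a unit quaternion
  \<open>q = w + x \<i> + y \<j> + z \<k>\<close>, stored with its real part first.
\<close>

definition quat_rotation :: "real ^ 4 \<Rightarrow> real ^ 3 ^ 3" where
  "quat_rotation q =
     (let w = q $ 1; x = q $ 2; y = q $ 3; z = q $ 4 in
      vector [vector [1 - 2 * (y\<^sup>2 + z\<^sup>2), 2 * (x * y - w * z), 2 * (x * z + w * y)],
              vector [2 * (x * y + w * z), 1 - 2 * (x\<^sup>2 + z\<^sup>2), 2 * (y * z - w * x)],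
              vector [2 * (x * z - w * y), 2 * (y * z + w * x), 1 - 2 * (x\<^sup>2 + y\<^sup>2)]])"

definition diag_matrix :: "real ^ 'n \<Rightarrow> real ^ 'n ^ 'n" where
  "diag_matrix s = (\<chi> i j. if i = j then s $ i else 0)"

definition sigmoid :: "real \<Rightarrow> real" where
  "sigmoid t = 1 / (1 + exp (- t))"

text \<open>
  A parameter tuple is \<open>(\<mu>, q, s, c, p)\<close> with \<open>p\<close> the opacity logit. The coefficient array \<open>c\<close>
  has rows indexed by the three color channels and columns by pairs \<open>(l, m)\<close>. Since the number
  of columns depends on \<open>L\<close>, a row is a function on all pairs; extensionality fixes its
  value outside \<open>sh_index L\<close>, so that equality of tuples is equality of their real entries.
\<close>

type_synonym sgrf_param =
  "(real ^ 3) \<times> (real ^ 4) \<times> (real ^ 3) \<times> ((nat \<times> int \<Rightarrow> real) ^ 3) \<times> real"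

definition sh_index :: "nat \<Rightarrow> (nat \<times> int) set" where
  "sh_index L = (SIGMA l:{0..L}. {- int l..int l})"

definition param_space :: "nat \<Rightarrow> sgrf_param set" where
  "param_space L =
     {(\<mu>, q, s, c, p). norm q = 1 \<and> (\<forall>i. 0 < s $ i) \<and> (\<forall>k. c $ k \<in> extensional (sh_index L))}"

definition covariance :: "real ^ 4 \<Rightarrow> real ^ 3 \<Rightarrow> real ^ 3 ^ 3" where
  "covariance q s =
     quat_rotation q ** (diag_matrix s ** diag_matrix s) ** transpose (quat_rotation q)"

definition gaussian_density :: "real ^ 3 \<Rightarrow> real ^ 3 ^ 3 \<Rightarrow> real ^ 3 \<Rightarrow> real" where
  "gaussian_density \<mu> S x = exp (- (1 / 2) * ((x - \<mu>) \<bullet> (matrix_inv S *v (x - \<mu>))))"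

definition sh_color :: "nat \<Rightarrow> (nat \<times> int \<Rightarrow> real) ^ 3 \<Rightarrow> real ^ 3 \<Rightarrow> real ^ 3" where
  "sh_color L c d =
     (\<chi> k. \<Sum>l = 0..L. \<Sum>m = - int l..int l. (c $ k) (l, m) * spherical_harmonic l m d)"

text \<open>The radiance field; the direction \<open>d\<close> is meant to range over the unit sphere.\<close>

definition sgrf :: "nat \<Rightarrow> sgrf_param \<Rightarrow> real ^ 3 \<Rightarrow> real ^ 3 \<Rightarrow> real ^ 3" where
  "sgrf L \<theta> x d =
     (case \<theta> of (\<mu>, q, s, c, p) \<Rightarrow>
        gaussian_density \<mu> (covariance q s) x *\<^sub>R (sigmoid p *\<^sub>R sh_color L c d))"

end

theory Submission
  imports Defs
begin

text \<open>
  Unit quaternions cover the rotation group twice: conjugation by \<open>q\<close> and by \<open>- q\<close> is the same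
  rotation. Negating the quaternion therefore changes any parameter tuple but not its field.
\<close>

lemma quat_rotation_uminus: "quat_rotation (- q) = quat_rotation q"
  \<comment> \<open>Every entry is a constant plus a quadratic form in the components of
    \<open>q\<close>, so the signs cancel.\<close>
  by (simp add: quat_rotation_def Let_def)

lemma sgrf_uminus_quat: "sgrf L (\<mu>, - q, s, c, p) = sgrf L (\<mu>, q, s, c, p)"
  by (simp add: sgrf_def covariance_def quat_rotation_uminus fun_eq_iff)

lemma param_space_uminus_quat:
  assumes "(\<mu>, q, s, c, p) \<in> param_space L"
  shows "(\<mu>, - q, s, c, p) \<in> param_space L" and "- q \<noteq> q"
proof -
  show "(\<mu>, - q, s, c, p) \<in> param_space L"
    using assms by (simp add: param_space_def)
  \<comment> \<open>Only the zero quaternion is its own negative, and \<open>norm q = 1\<close>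
    excludes it.\<close>
  have "q \<noteq> 0"
    using assms by (auto simp: param_space_def)
  then show "- q \<noteq> q"
    by (simp add: vec_eq_iff)
qed

lemma param_space_nonempty: "param_space L \<noteq> {}"
proof -
  \<comment> \<open>The real part comes first, so \<open>axis 1 1\<close> is the quaternion 1, the
    identity rotation. Extensionality forces \<open>undefined\<close> outside
    \<open>sh_index L\<close>; inside, any coefficients would do.\<close>
  have "(0, axis 1 1, (\<chi> i. 1), (\<chi> k. (\<lambda>_. undefined)), 0) \<in> param_space L"
    by (simp add: param_space_def norm_axis_1 extensional_def)
  then show ?thesis
    by blast
qed

theorem proposition1:
  fixes L :: nat
  shows "\<exists>\<theta>1 \<in> param_space L. \<exists>\<theta>2 \<in> param_space L.
           \<theta>1 \<noteq> \<theta>2 \<and>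
           (\<forall>x :: real ^ 3. \<forall>d \<in> sphere (0 :: real ^ 3) 1. sgrf L \<theta>1 x d = sgrf L \<theta>2 x d)"
proof -
  obtain \<mu> q s c p where \<theta>: "(\<mu>, q, s, c, p) \<in> param_space L"
    using param_space_nonempty by fastforce
  show ?thesis
  proof (intro bexI conjI allI ballI)
    show "(\<mu>, - q, s, c, p) \<noteq> (\<mu>, q, s, c, p)"
      using param_space_uminus_quat(2)[OF \<theta>] by simp
  qed (use \<theta> param_space_uminus_quat(1)[OF \<theta>] in \<open>simp_all add: sgrf_uminus_quat\<close>)
qed

end
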